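(* Let $(G,\mathcal P_G)$ and $(H,\mathcal P_H)$ be two partitioned graphs and denote by $A_G$ and $A_H$ the adjacency matrices of $G$ and $H$ respectively. Let $U$ be a quantum isomorphism of partitioned graphs from $(G,\mathcal P_G)$ to $(H,\mathcal P_H)$ with coefficients in a unital $C^*$-algebra $X$. Take $C\in\mathcal P_G$ and $D\in\mathcal P_H$, let $W=U[D,C]$ and $p=p_{DC}(U)$. Then: (1) the matrix $P(U)=(p_{KL}(U))_{K\in\mathcal P_H,\,L\in\mathcal P_G}$ is a magic unitary with coefficients in $X$; (2) if $p\neq 0$, then $p$ is the unit of the $C^*$-subalgebra $Y$ of $X$ generated by the coefficients of $W$; (3) if $p=0$, then $W=0$; (4) if $p\neq 0$, then $W$ is a magic unitary with coefficients in $Y$; (5) $A_H[D,D]\,W=W\,A_G[C,C]$. In particular, there is a bijection $\varphi:\mathcal P_G\to\mathcal P_H$ such that $U[\varphi(S),S]$ is a quantum isomorphism from $G[S]$ to $H[\varphi(S)]$ for every $S\in\mathcal P_G$.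
   Context: All graphs are finite and simple. $G[S]$ is the subgraph induced on $S\subseteq V(G)$; $M[T,S]$ denotes the submatrix of $M$ with rows indexed by $T$ and columns indexed by $S$. A magic unitary with coefficients in a (nonzero) unital $C^*$-algebra $X$ is a matrix $U=(u_{ij})_{i\in I,j\in J}$ with $I,J$ finite, $u_{ij}=u_{ij}^2=u_{ij}^*\in X$, and $\sum_{k\in I}u_{kj}=1=\sum_{k\in J}u_{ik}$ for all $i,j$. A quantum isomorphism from a graph $G$ to a graph $H$ with the same number of vertices is a magic unitary $U$ indexed by $V(H)\times V(G)$ with $U\,\mathrm{Adj}(G)=\mathrm{Adj}(H)\,U$. Submatrices of $U$ are regarded as having coefficients in the $C^*$-subalgebra of $X$ generated by their entries, whose unit (when it exists) need not be the unit of $X$; in particular, in the last assertion $U[\varphi(S),S]$ is regarded as a matrix over the $C^*$-subalgebra generated by its entries. A partitioned graph is a pair $(G,\mathcal P)$ with $G$ a graph and $\mathcal P$ a partition of $V(G)$ (into nonempty cells); $\sim_{\mathcal P}$ is the associated equivalence relation. A quantum isomorphism $U$ from $G$ to $H$ is a quantum isomorphism of partitioned graphs from $(G,\mathcal P_G)$ to $(H,\mathcal P_H)$ if for all $x,y\in V(G)$ and $a,b\in V(H)$: $u_{ax}u_{by}=0$ whenever ($x\sim_{\mathcal P_G}y$ and $a\not\sim_{\mathcal P_H}b$) or ($x\not\sim_{\mathcal P_G}y$ and $a\sim_{\mathcal P_H}b$). For such $U$ and $K\in\mathcal P_H$, $L\in\mathcal P_G$, define $p_{KL}(U)=\sum_{d\in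 K}u_{dx}$ for any $x\in L$; this is a projection that does not depend on the choice of $x\in L$. *)

theory Defs
  imports "HOL-Analysis.Analysis" "Graph_Theory.Digraph_Component"
begin

section \<open>Unital C*-algebras\<close>

text \<open>
  The distribution has no complex vector spaces as a type class. The scalar action of the complex
  numbers is therefore added on top of the real one, and \<open>scaleR_conv_scaleC\<close> makes the two agree.
  The superclass \<^class>\<open>real_normed_algebra_1\<close> provides the unit, submultiplicativity of the norm
  and \<open>0 \<noteq> 1\<close>, so the algebras of this class are nonzero. Its axiom \<open>norm 1 = 1\<close> is no restriction,
  as it follows from the C*-identity in a nonzero algebra.
\<close>

class cstar_algebra_1 = real_normed_algebra_1 + banach +
  fixes scaleC :: "complex \<Rightarrow> 'a \<Rightarrow> 'a" (infixr "*\<^sub>C" 75)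
    and star :: "'a \<Rightarrow> 'a"
  assumes scaleC_add_right: "c *\<^sub>C (x + y) = c *\<^sub>C x + c *\<^sub>C y"
    and scaleC_add_left: "(c + d) *\<^sub>C x = c *\<^sub>C x + d *\<^sub>C x"
    and scaleC_scaleC: "c *\<^sub>C d *\<^sub>C x = (c * d) *\<^sub>C x"
    and scaleR_conv_scaleC: "r *\<^sub>R x = complex_of_real r *\<^sub>C x"
    and norm_scaleC: "norm (c *\<^sub>C x) = cmod c * norm x"
    and mult_scaleC_left: "(c *\<^sub>C x) * y = c *\<^sub>C (x * y)"
    and mult_scaleC_right: "x * (c *\<^sub>C y) = c *\<^sub>C (x * y)"
    and star_add: "star (x + y) = star x + star y"
    and star_scaleC: "star (c *\<^sub>C x) = cnj c *\<^sub>C star x"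
    and star_mult: "star (x * y) = star y * star x"
    and star_star: "star (star x) = x"
    and norm_star_mult_self: "norm (star x * x) = (norm x)\<^sup>2"

instantiation complex :: cstar_algebra_1
begin

definition scaleC_complex :: "complex \<Rightarrow> complex \<Rightarrow> complex"
  where "scaleC_complex = (*)"

definition star_complex :: "complex \<Rightarrow> complex"
  where "star_complex = cnj"

instance
  by standard
    (auto simp: scaleC_complex_def star_complex_def algebra_simps scaleR_conv_of_real norm_mult
      power2_eq_square)

end

text \<open>
  A C*-subalgebra need not contain the unit \<open>1\<close> of the ambient algebra. If it has a unit of its own,
  that unit may differ from \<open>1\<close>.
\<close>

definition cstar_subalgebra :: "'a::cstar_algebra_1 set \<Rightarrow> bool"
  where "cstar_subalgebra A \<longleftrightarrow>
    closed A \<and> 0 \<in> A \<and>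
    (\<forall>x\<in>A. \<forall>y\<in>A. x + y \<in> A \<and> x * y \<in> A) \<and>
    (\<forall>c. \<forall>x\<in>A. c *\<^sub>C x \<in> A) \<and>
    (\<forall>x\<in>A. star x \<in> A)"

definition cstar_generated :: "'a::cstar_algebra_1 set \<Rightarrow> 'a set"
  where "cstar_generated S = cstar_subalgebra hull S"

definition is_unit_of :: "'a::cstar_algebra_1 \<Rightarrow> 'a set \<Rightarrow> bool"
  where "is_unit_of e A \<longleftrightarrow> e \<in> A \<and> (\<forall>x\<in>A. e * x = x \<and> x * e = x)"

section \<open>Magic unitaries\<close>

text \<open>
  A matrix with rows indexed by \<open>I\<close> and columns indexed by \<open>J\<close> is a function \<open>u\<close> whose values
  \<open>u i j\<close> matter for \<open>i \<in> I\<close> and \<open>j \<in> J\<close> only. The submatrix \<open>u[I', J']\<close> is thus the same function,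
  considered on \<open>I'\<close> and \<open>J'\<close>.
\<close>

definition entries :: "'i set \<Rightarrow> 'j set \<Rightarrow> ('i \<Rightarrow> 'j \<Rightarrow> 'a) \<Rightarrow> 'a set"
  where "entries I J u = {u i j |i j. i \<in> I \<and> j \<in> J}"

text \<open>
  Coefficients in the nonzero unital C*-algebra \<open>A\<close>: the \<open>1\<close> of the definition of a magic unitary is
  the unit \<open>e\<close> of \<open>A\<close>. The ambient algebra itself is the case \<open>A = UNIV\<close>, \<open>e = 1\<close>.
\<close>

definition magic_unitary ::
    "'a::cstar_algebra_1 set \<Rightarrow> 'i set \<Rightarrow> 'j set \<Rightarrow> ('i \<Rightarrow> 'j \<Rightarrow> 'a) \<Rightarrow> bool"
  where "magic_unitary A I J u \<longleftrightarrow>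
    cstar_subalgebra A \<and> finite I \<and> finite J \<and> entries I J u \<subseteq> A \<and>
    (\<forall>i\<in>I. \<forall>j\<in>J. u i j = (u i j)\<^sup>2 \<and> u i j = star (u i j)) \<and>
    (\<exists>e. is_unit_of e A \<and> e \<noteq> 0 \<and>
      (\<forall>j\<in>J. (\<Sum>k\<in>I. u k j) = e) \<and> (\<forall>i\<in>I. (\<Sum>k\<in>J. u i k) = e))"

section \<open>Quantum isomorphisms\<close>

text \<open>
  Finite simple graphs are the digraphs satisfying \<^locale>\<open>graph\<close>: finite, symmetric, without loops
  and without parallel arcs. The subgraph induced on \<open>S\<close> is \<open>G \<restriction> S\<close>.
\<close>

definition adj_matrix :: "('v, 'e) pre_digraph \<Rightarrow> 'v \<Rightarrow> 'v \<Rightarrow> complex"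
  where "adj_matrix G x y = (if x \<rightarrow>\<^bsub>G\<^esub> y then 1 else 0)"

definition scalar_mat_mult ::
    "'j set \<Rightarrow> ('i \<Rightarrow> 'j \<Rightarrow> complex) \<Rightarrow> ('j \<Rightarrow> 'k \<Rightarrow> 'a) \<Rightarrow> 'i \<Rightarrow> 'k \<Rightarrow> 'a::cstar_algebra_1"
  where "scalar_mat_mult J M u i k = (\<Sum>j\<in>J. M i j *\<^sub>C u j k)"

definition mat_scalar_mult ::
    "'j set \<Rightarrow> ('i \<Rightarrow> 'j \<Rightarrow> 'a) \<Rightarrow> ('j \<Rightarrow> 'k \<Rightarrow> complex) \<Rightarrow> 'i \<Rightarrow> 'k \<Rightarrow> 'a::cstar_algebra_1"
  where "mat_scalar_mult J u M i k = (\<Sum>j\<in>J. M j k *\<^sub>C u i j)"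

definition quantum_iso ::
    "'a::cstar_algebra_1 set \<Rightarrow> ('g, 'e) pre_digraph \<Rightarrow> ('h, 'f) pre_digraph \<Rightarrow> ('h \<Rightarrow> 'g \<Rightarrow> 'a) \<Rightarrow> bool"
  where "quantum_iso A G H u \<longleftrightarrow>
    card (verts G) = card (verts H) \<and>
    magic_unitary A (verts H) (verts G) u \<and>
    (\<forall>a\<in>verts H. \<forall>x\<in>verts G.
      mat_scalar_mult (verts G) u (adj_matrix G) a x = scalar_mat_mult (verts H) (adj_matrix H) u a x)"

definition partitioned_graph :: "('v, 'e) pre_digraph \<Rightarrow> 'v set set \<Rightarrow> bool"
  where "partitioned_graph G P \<longleftrightarrow> graph G \<and> partition_on (verts G) P"

definition same_cell :: "'v set set \<Rightarrow> 'v \<Rightarrow> 'v \<Rightarrow> bool"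
  where "same_cell P x y \<longleftrightarrow> (\<exists>S\<in>P. x \<in> S \<and> y \<in> S)"

definition partitioned_quantum_iso ::
    "'a::cstar_algebra_1 set \<Rightarrow> ('g, 'e) pre_digraph \<Rightarrow> 'g set set \<Rightarrow>
      ('h, 'f) pre_digraph \<Rightarrow> 'h set set \<Rightarrow> ('h \<Rightarrow> 'g \<Rightarrow> 'a) \<Rightarrow> bool"
  where "partitioned_quantum_iso A G P H Q u \<longleftrightarrow>
    quantum_iso A G H u \<and>
    (\<forall>x\<in>verts G. \<forall>y\<in>verts G. \<forall>a\<in>verts H. \<forall>b\<in>verts H.
      (same_cell P x y \<and> \<not> same_cell Q a b) \<or> (\<not> same_cell P x y \<and> same_cell Q a b) \<longrightarrow>
      u a x * u b y = 0)"

text \<open>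
  The column \<open>x \<in> L\<close> in the definition of \<open>p\<^bsub>KL\<^esub>(u)\<close> is chosen arbitrarily. Lemma \<open>cell_sum_eq\<close>
  below states that the choice is immaterial.
\<close>

definition cell_sum :: "('h \<Rightarrow> 'g \<Rightarrow> 'a) \<Rightarrow> 'h set \<Rightarrow> 'g set \<Rightarrow> 'a::cstar_algebra_1"
  where "cell_sum u K L = (\<Sum>d\<in>K. u d (SOME x. x \<in> L))"

lemma sum_column_indep:
  fixes u :: "'h \<Rightarrow> 'g \<Rightarrow> 'a::cstar_algebra_1"
  assumes Q: "partition_on (verts H) Q"
    and u: "partitioned_quantum_iso UNIV G P H Q u"
    and K: "K \<in> Q" and x: "x \<in> verts G" and y: "y \<in> verts G" and xy: "same_cell P x y"
  shows "(\<Sum>d\<in>K. u d x) = (\<Sum>d\<in>K. u d y)"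
proof -
  let ?V = "verts H"
  have magic: "magic_unitary UNIV ?V (verts G) u"
    using u by (simp add: partitioned_quantum_iso_def quantum_iso_def)
  then obtain e where e: "is_unit_of e (UNIV :: 'a set)"
    and col: "\<And>z. z \<in> verts G \<Longrightarrow> (\<Sum>k\<in>?V. u k z) = e"
    unfolding magic_unitary_def by blast
  have fin: "finite ?V"
    using magic by (simp add: magic_unitary_def)
  have KV: "K \<subseteq> ?V"
    using Q K by (auto simp: partition_on_def)
  have cell: "same_cell Q a b \<longleftrightarrow> b \<in> K" if "a \<in> K" for a b
    using Q K that by (auto simp: same_cell_def partition_on_def disjoint_def)
  have cell': "same_cell Q a b \<longleftrightarrow> a \<in> K" if "b \<in> K" for a b
    using cell[OF that] by (auto simp: same_cell_def)
  have orth: "u a x * u b y = 0" if "a \<in> ?V" "b \<in> ?V" "\<not> same_cell Q a b" for a b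
    using u x y xy that by (auto simp: partitioned_quantum_iso_def)
  have "(\<Sum>d\<in>K. u d x) = (\<Sum>d\<in>K. u d x) * (\<Sum>b\<in>?V. u b y)"
    using e col[OF y] by (simp add: is_unit_of_def)
  also have "\<dots> = (\<Sum>d\<in>K. \<Sum>b\<in>?V. u d x * u b y)"
    by (simp add: sum_product)
  also have "\<dots> = (\<Sum>d\<in>K. \<Sum>b\<in>K. u d x * u b y)"
    using KV fin cell orth by (intro sum.cong refl sum.mono_neutral_right) auto
  also have "\<dots> = (\<Sum>b\<in>K. \<Sum>d\<in>K. u d x * u b y)"
    by (rule sum.swap)
  also have "\<dots> = (\<Sum>b\<in>K. \<Sum>d\<in>?V. u d x * u b y)"
    using KV fin cell' orth by (intro sum.cong refl sum.mono_neutral_left) auto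
  also have "\<dots> = (\<Sum>d\<in>?V. u d x) * (\<Sum>b\<in>K. u b y)"
    by (simp add: sum_product sum.swap[of _ K])
  also have "\<dots> = (\<Sum>b\<in>K. u b y)"
    using e col[OF x] by (simp add: is_unit_of_def)
  finally show ?thesis .
qed

lemma cell_sum_eq:
  assumes P: "partition_on (verts G) P" and Q: "partition_on (verts H) Q"
    and u: "partitioned_quantum_iso UNIV G P H Q u"
    and K: "K \<in> Q" and L: "L \<in> P" and x: "x \<in> L"
  shows "cell_sum u K L = (\<Sum>d\<in>K. u d x)"
proof -
  have "(SOME x. x \<in> L) \<in> L"
    using x by (rule someI)
  then show ?thesis
    unfolding cell_sum_def using P L x
    by (intro sum_column_indep[OF Q u K]) (auto simp: partition_on_def same_cell_def)
qed

end

theory Submission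
  imports Defs
begin

text \<open>
  Entries in positions \<open>(a, x)\<close> and \<open>(b, y)\<close> multiply to \<open>0\<close> when exactly one of the pairs \<open>a, b\<close> and
  \<open>x, y\<close> lies in a common cell. Hence multiplication by \<open>p = p\<^bsub>DC\<^esub>(U)\<close> fixes the entries of \<open>U[D, C]\<close>
  and kills the remaining entries in the rows of \<open>D\<close> and in the columns of \<open>C\<close>. This makes \<open>p\<close> a
  projection and the unit of the block, and multiplying \<open>A\<^sub>H U = U A\<^sub>G\<close> by \<open>p\<close> yields the intertwining
  relation of the block. For the bijection, the nonzero pattern of the magic unitary \<open>P(U)\<close> satisfies
  Hall's condition, so the marriage theorem provides a system of nonzero \<open>p\<^bsub>\<phi>(S)S\<^esub>(U)\<close>.
\<close>

section \<open>Hall's marriage theorem for finite families\<close>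

lemma hall_marriage:
  assumes "finite I" and "\<And>i. i \<in> I \<Longrightarrow> finite (N i)"
    and "\<And>T. T \<subseteq> I \<Longrightarrow> card T \<le> card (\<Union>(N ` T))"
  shows "\<exists>f. inj_on f I \<and> (\<forall>i\<in>I. f i \<in> N i)"
  using assms
proof (induction I arbitrary: N rule: finite_psubset_induct)
  case (psubset I)
  note hall = psubset.prems(2)
  show ?case
  \<comment> \<open>The split asks for a tight set: a nonempty proper \<open>T\<close> with no more
    neighbours than elements. If there is one, \<open>T\<close> and \<open>I - T\<close> are matched
    separately, and \<open>I - T\<close> is denied all neighbours of \<open>T\<close>.\<close>
  proof (cases "\<exists>T. T \<noteq> {} \<and> T \<subset> I \<and> card (\<Union>(N ` T)) \<le> card T")
    case True
    then obtain T where T: "T \<noteq> {}" "T \<subset> I" "card (\<Union>(N ` T)) \<le> card T"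
      by blast
    obtain f where f: "inj_on f T" "\<forall>i\<in>T. f i \<in> N i"
      using psubset.IH[OF T(2), of N] psubset.prems T(2) by (meson order_trans psubset_imp_subset subsetD)
    let ?N = "\<lambda>j. N j - \<Union>(N ` T)"
    have "\<exists>g. inj_on g (I - T) \<and> (\<forall>i\<in>I - T. g i \<in> ?N i)"
    proof (rule psubset.IH)
      show "I - T \<subset> I"
        using T by blast
      show "finite (?N i)" if "i \<in> I - T" for i
        using that psubset.prems(1) by blast
      \<comment> \<open>Hall's condition for \<open>S\<close> after the removal is the one for
        \<open>S \<union> T\<close> with the tight part \<open>T\<close> cancelled.\<close>
      show "card S \<le> card (\<Union>(?N ` S))" if S: "S \<subseteq> I - T" for S
      proof -
        have "card S + card T = card (S \<union> T)"
          using S T(2) psubset.hyps by (subst card_Un_disjoint) (auto intro: finite_subset)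
        also have "\<dots> \<le> card (\<Union>(N ` (S \<union> T)))"
          using S T(2) by (intro hall) blast
        also have "\<Union>(N ` (S \<union> T)) = \<Union>(?N ` S) \<union> \<Union>(N ` T)"
          by blast
        also have "card \<dots> \<le> card (\<Union>(?N ` S)) + card (\<Union>(N ` T))"
          by (rule card_Un_le)
        finally show ?thesis
          using T(3) by linarith
      qed
    qed
    then obtain g where g: "inj_on g (I - T)" "\<forall>i\<in>I - T. g i \<in> ?N i"
      by (elim exE conjE) (rule that)
    have ne: "f i \<noteq> g j" if "i \<in> T" "j \<in> I - T" for i j
    proof -
      have "g j \<notin> \<Union>(N ` T)" "f i \<in> N i"
        using f(2) g(2) that by auto
      then show ?thesis
        using that(1) by auto
    qed
    have "inj_on (\<lambda>i. if i \<in> T then f i else g i) I"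
    proof (rule inj_onI)
      fix i j
      assume "i \<in> I" "j \<in> I" "(if i \<in> T then f i else g i) = (if j \<in> T then f j else g j)"
      then show "i = j"
        using ne[of i j] ne[of j i] inj_onD[OF f(1), of i j] inj_onD[OF g(1), of i j]
        by (auto split: if_splits)
    qed
    moreover have "\<forall>i\<in>I. (if i \<in> T then f i else g i) \<in> N i"
      using f(2) g(2) by simp
    ultimately show ?thesis
      by (intro exI conjI)
  next
    case False
    \<comment> \<open>Without a tight set every nonempty proper subset has a neighbour to spare, so
      any \<open>x\<close> in \<open>N i\<close> can be given to \<open>i\<close> and withdrawn from
      all others.\<close>
    have strict: "card T < card (\<Union>(N ` T))" if "T \<noteq> {}" "T \<subset> I" for T
      using False that by (metis not_le)
    show ?thesis
    proof (cases "I = {}")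
      case nonempty: False
      then obtain i where i: "i \<in> I"
        by blast
      have "N i \<noteq> {}"
        using hall[of "{i}"] i by auto
      then obtain x where x: "x \<in> N i"
        by blast
      have "\<exists>g. inj_on g (I - {i}) \<and> (\<forall>j\<in>I - {i}. g j \<in> N j - {x})"
      proof (rule psubset.IH)
        show "I - {i} \<subset> I"
          using i by blast
        show "finite (N j - {x})" if "j \<in> I - {i}" for j
          using that psubset.prems(1) by blast
        show "card S \<le> card (\<Union>j\<in>S. N j - {x})" if S: "S \<subseteq> I - {i}" for S
        proof (cases "S = {}")
          case nonempty: False
          have "S \<subset> I"
            using S i by blast
          then have "card S < card (\<Union>(N ` S))"
            by (rule strict[OF nonempty])
          moreover have "card (\<Union>(N ` S)) - card {x} \<le> card (\<Union>(N ` S) - {x})"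
            by (rule diff_card_le_card_Diff) simp
          ultimately have "card S \<le> card (\<Union>(N ` S) - {x})"
            by simp
          then show ?thesis
            by (simp only: UN_simps)
        qed simp
      qed
      then obtain g where g: "inj_on g (I - {i})" "\<forall>j\<in>I - {i}. g j \<in> N j - {x}"
        by (elim exE conjE) (rule that)
      have "inj_on (g(i := x)) (insert i (I - {i}))"
        using g by (subst inj_on_insert) (auto simp: inj_on_def)
      then have "inj_on (g(i := x)) I"
        using i by (simp add: insert_absorb)
      moreover have "\<forall>j\<in>I. (g(i := x)) j \<in> N j"
        using g(2) x by simp
      ultimately show ?thesis
        by (intro exI conjI)
    qed simp
  qed
qed

section \<open>Projections, generated C*-subalgebras and their units\<close>

lemma star_zero [simp]: "star (0 :: 'a::cstar_algebra_1) = 0"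
  using star_add[of "0 :: 'a" 0] by simp

lemma scaleC_zero_right [simp]: "c *\<^sub>C (0 :: 'a::cstar_algebra_1) = 0"
  using scaleC_add_right[of c "0 :: 'a" 0] by simp

lemma star_diff: "star (x - y) = star x - star (y :: 'a::cstar_algebra_1)"
  using star_add[of "x - y" y] by simp

lemma star_sum: "star (sum f A) = (\<Sum>i\<in>A. star (f i :: 'a::cstar_algebra_1))"
  by (induction A rule: infinite_finite_induct) (auto simp: star_add)

text \<open>By the C*-identity \<open>norm p\<close> equals its own square, hence is 0 or 1. The
  bound serves for complements \<open>e - u i j\<close>, which may vanish.\<close>

lemma norm_projection_le_1:
  fixes p :: "'a::cstar_algebra_1"
  assumes "p * p = p" and "star p = p"
  shows "norm p \<le> 1"
  using norm_star_mult_self[of p] assms by (cases "p = 0") (simp_all add: power2_eq_square)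

lemma norm_projection_eq_1:
  fixes p :: "'a::cstar_algebra_1"
  assumes "p * p = p" and "star p = p" and "p \<noteq> 0"
  shows "norm p = 1"
  using norm_star_mult_self[of p] assms by (simp add: power2_eq_square)

lemma cstar_subalgebra_sum:
  assumes "cstar_subalgebra A" and "\<And>i. i \<in> I \<Longrightarrow> f i \<in> A"
  shows "sum f I \<in> A"
  using assms(2)
proof (induction I rule: infinite_finite_induct)
  case (insert i I)
  then show ?case
    using assms(1) by (auto simp: cstar_subalgebra_def)
qed (use assms(1) in \<open>auto simp: cstar_subalgebra_def\<close>)

text \<open>All defining conditions of a C*-subalgebra survive arbitrary intersections.\<close>

lemma cstar_subalgebra_cstar_generated: "cstar_subalgebra (cstar_generated S)"
  unfolding cstar_generated_def
  by (rule hull_in) (auto simp: cstar_subalgebra_def intro: closed_Inter)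

lemma subset_cstar_generated: "S \<subseteq> cstar_generated S"
  unfolding cstar_generated_def by (rule hull_subset)

lemma cstar_generated_minimal:
  "S \<subseteq> A \<Longrightarrow> cstar_subalgebra A \<Longrightarrow> cstar_generated S \<subseteq> A"
  unfolding cstar_generated_def by (rule hull_minimal)

text \<open>Applying \<open>star\<close> exchanges the two equations because \<open>p\<close> is
  self-adjoint. By minimality, a \<open>p\<close> that acts as an identity on generators then does
  so on everything they generate.\<close>

lemma cstar_subalgebra_unital_for:
  assumes "star p = (p :: 'a::cstar_algebra_1)"
  shows "cstar_subalgebra {x. p * x = x \<and> x * p = x}"
proof -
  have "p * star x = star x \<and> star x * p = star x" if "p * x = x" "x * p = x" for x
    using that star_mult[of x p] star_mult[of p x] assms by auto
  moreover have "closed {x. p * x = x \<and> x * p = x}"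
    by (intro closed_Collect_conj closed_Collect_eq continuous_intros)
  ultimately show ?thesis
    unfolding cstar_subalgebra_def
    by (auto simp: distrib_left distrib_right mult.assoc mult_scaleC_left mult_scaleC_right)
       (metis mult.assoc)
qed

lemma is_unit_of_cstar_generated:
  assumes "star p = p" and "p \<in> cstar_generated S" and "\<And>x. x \<in> S \<Longrightarrow> p * x = x \<and> x * p = x"
  shows "is_unit_of p (cstar_generated S)"
  using cstar_generated_minimal[OF _ cstar_subalgebra_unital_for[OF assms(1)], of S] assms(2,3)
  by (auto simp: is_unit_of_def)

text \<open>The product \<open>e * star e\<close> is self-adjoint and equals \<open>star e\<close>.
  So \<open>e\<close> is a projection, and a nonzero one has norm 1.\<close>

lemma star_unit_of:
  assumes "cstar_subalgebra A" and "is_unit_of e A"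
  shows "star e = e"
proof -
  have "star e \<in> A"
    using assms by (simp add: cstar_subalgebra_def is_unit_of_def)
  then have "e * star e = star e"
    using assms by (simp add: is_unit_of_def)
  then show ?thesis
    using star_mult[of e "star e"] by (simp add: star_star)
qed

section \<open>Square shape and nonzero transversals of magic unitaries\<close>

lemma magic_unitary_card_eq:
  assumes "magic_unitary A I J u"
  shows "card I = card J"
proof -
  obtain e where e: "e \<noteq> 0" and col: "\<forall>j\<in>J. (\<Sum>k\<in>I. u k j) = e"
    and row: "\<forall>i\<in>I. (\<Sum>k\<in>J. u i k) = e"
    using assms by (auto simp: magic_unitary_def)
  \<comment> \<open>Double counting: the sum of all entries is taken by rows and by columns.\<close>
  have "real (card I) *\<^sub>R e = (\<Sum>i\<in>I. \<Sum>j\<in>J. u i j)"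
    using row by (simp add: scaleR_conv_of_real)
  also have "\<dots> = (\<Sum>j\<in>J. \<Sum>i\<in>I. u i j)"
    by (rule sum.swap)
  also have "\<dots> = real (card J) *\<^sub>R e"
    using col by (simp add: scaleR_conv_of_real)
  finally show ?thesis
    using e by simp
qed

text \<open>
  With \<open>N\<close> the set of rows meeting the columns \<open>T\<close>, the complements \<open>e - u i j\<close> for \<open>i \<in> N\<close> and
  \<open>j \<in> J - T\<close> are \<open>n\<close> projections with sum \<open>(n + card T - card N) e\<close>. Comparing norms takes the place
  of an appeal to positivity in C*-algebras.
\<close>

lemma magic_unitary_hall_condition:
  assumes u: "magic_unitary A I J u" and T: "T \<subseteq> J"
  shows "card T \<le> card {i \<in> I. \<exists>j\<in>T. u i j \<noteq> 0}"
proof -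
  let ?N = "{i \<in> I. \<exists>j\<in>T. u i j \<noteq> 0}"
  obtain e where A: "cstar_subalgebra A" and unit: "is_unit_of e A" and e: "e \<noteq> 0"
    and col: "\<forall>j\<in>J. (\<Sum>k\<in>I. u k j) = e" and row: "\<forall>i\<in>I. (\<Sum>k\<in>J. u i k) = e"
    and fin: "finite I" "finite J" and sub: "entries I J u \<subseteq> A"
    and proj: "\<forall>i\<in>I. \<forall>j\<in>J. u i j = (u i j)\<^sup>2 \<and> u i j = star (u i j)"
    using u by (auto simp: magic_unitary_def)
  have norm_e: "norm e = 1"
    using norm_projection_eq_1[of e] star_unit_of[OF A unit] unit e by (auto simp: is_unit_of_def)
  have le1: "norm (e - u i j) \<le> 1" if "i \<in> I" "j \<in> J" for i j
  proof (rule norm_projection_le_1)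
    have "u i j \<in> A" "e \<in> A"
      using sub unit that by (auto simp: entries_def is_unit_of_def)
    moreover have "u i j * u i j = u i j"
      using proj that by (metis power2_eq_square)
    ultimately show "(e - u i j) * (e - u i j) = e - u i j"
      using unit by (simp add: is_unit_of_def algebra_simps)
    show "star (e - u i j) = e - u i j"
      using proj that by (metis star_diff star_unit_of[OF A unit])
  qed
  have fin': "finite ?N" "finite T"
    using fin T by (auto intro: finite_subset)
  have "real (card T) *\<^sub>R e = (\<Sum>j\<in>T. \<Sum>i\<in>I. u i j)"
    using col T by (auto simp: scaleR_conv_of_real subset_iff)
  \<comment> \<open>Rows outside \<open>?N\<close> vanish on the columns \<open>T\<close>.\<close>
  also have "\<dots> = (\<Sum>j\<in>T. \<Sum>i\<in>?N. u i j)"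
    using fin by (intro sum.cong refl sum.mono_neutral_right) auto
  also have "\<dots> = (\<Sum>i\<in>?N. \<Sum>j\<in>T. u i j)"
    by (rule sum.swap)
  finally have T_eq: "(\<Sum>i\<in>?N. \<Sum>j\<in>T. u i j) = real (card T) *\<^sub>R e"
    by simp
  have N_eq: "(\<Sum>i\<in>?N. \<Sum>j\<in>J. u i j) = real (card ?N) *\<^sub>R e"
    using row by (simp add: scaleR_conv_of_real)
  have "(\<Sum>i\<in>?N. \<Sum>j\<in>J - T. u i j) = (\<Sum>i\<in>?N. (\<Sum>j\<in>J. u i j) - (\<Sum>j\<in>T. u i j))"
    using fin T by (simp add: sum_diff)
  also have "\<dots> = real (card ?N) *\<^sub>R e - real (card T) *\<^sub>R e"
    by (simp only: sum_subtractf T_eq N_eq)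
  finally have rest: "(\<Sum>i\<in>?N. \<Sum>j\<in>J - T. u i j) = real (card ?N) *\<^sub>R e - real (card T) *\<^sub>R e" .
  define n where "n = real (card ?N) * real (card (J - T))"
  have "(\<Sum>i\<in>?N. \<Sum>j\<in>J - T. e - u i j) = n *\<^sub>R e - (real (card ?N) *\<^sub>R e - real (card T) *\<^sub>R e)"
    by (simp only: sum_subtractf rest) (simp add: n_def scaleR_conv_of_real mult.assoc)
  also have "\<dots> = (n + real (card T) - real (card ?N)) *\<^sub>R e"
    by (simp add: algebra_simps)
  \<comment> \<open>As \<open>norm e = 1\<close>, the norm of a real multiple of \<open>e\<close> is
    the absolute value of the coefficient, which bounds the coefficient whatever its sign.\<close>
  finally have "n + real (card T) - real (card ?N) \<le> norm (\<Sum>i\<in>?N. \<Sum>j\<in>J - T. e - u i j)"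
    using norm_e by simp
  also have "\<dots> \<le> (\<Sum>i\<in>?N. \<Sum>j\<in>J - T. 1)"
    by (intro sum_norm_le le1) auto
  also have "\<dots> = n"
    by (simp add: n_def)
  finally show ?thesis
    by simp
qed

lemma magic_unitary_transversal:
  assumes u: "magic_unitary A I J u"
  shows "\<exists>\<phi>. bij_betw \<phi> J I \<and> (\<forall>j\<in>J. u (\<phi> j) j \<noteq> 0)"
proof -
  have fin: "finite I" "finite J"
    using u by (auto simp: magic_unitary_def)
  have "card T \<le> card (\<Union>j\<in>T. {i \<in> I. u i j \<noteq> 0})" if "T \<subseteq> J" for T
  proof -
    have "(\<Union>j\<in>T. {i \<in> I. u i j \<noteq> 0}) = {i \<in> I. \<exists>j\<in>T. u i j \<noteq> 0}"
      by blast
    then show ?thesis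
      using magic_unitary_hall_condition[OF u that] by simp
  qed
  then obtain \<phi> where \<phi>: "inj_on \<phi> J" "\<forall>j\<in>J. \<phi> j \<in> {i \<in> I. u i j \<noteq> 0}"
    using hall_marriage[of J "\<lambda>j. {i \<in> I. u i j \<noteq> 0}"] fin by auto
  \<comment> \<open>An injection between finite sets of equal size is onto.\<close>
  then have "\<phi> ` J = I"
    using fin magic_unitary_card_eq[OF u] by (intro card_subset_eq) (auto simp: card_image)
  then show ?thesis
    using \<phi> by (auto simp: bij_betw_def)
qed

lemma adj_matrix_induce_subgraph:
  assumes "x \<in> S" and "y \<in> S"
  shows "adj_matrix (G \<restriction> S) x y = adj_matrix G x y"
  using assms
  by (auto simp: adj_matrix_def arcs_ends_def arc_to_ends_def induce_subgraph_def image_iff)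

lemma same_cell_iff:
  assumes "partition_on V R" and "S \<in> R" and "x \<in> S"
  shows "same_cell R x y \<longleftrightarrow> y \<in> S" and "same_cell R y x \<longleftrightarrow> y \<in> S"
proof -
  show *: "same_cell R x y \<longleftrightarrow> y \<in> S"
    using assms by (auto simp: same_cell_def partition_on_def disjoint_def)
  show "same_cell R y x \<longleftrightarrow> y \<in> S"
    using * by (auto simp: same_cell_def)
qed

section \<open>Cell sums as projections acting on the entries\<close>

context
  fixes G :: "('g, 'e) pre_digraph" and H :: "('h, 'f) pre_digraph"
    and P :: "'g set set" and Q :: "'h set set"
    and u :: "'h \<Rightarrow> 'g \<Rightarrow> 'x::cstar_algebra_1"
  assumes P: "partition_on (verts G) P" and Q: "partition_on (verts H) Q"
    and u: "partitioned_quantum_iso UNIV G P H Q u"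
begin

lemma finite_verts_pqi: "finite (verts G)" "finite (verts H)"
  using u by (auto simp: partitioned_quantum_iso_def quantum_iso_def magic_unitary_def)

lemma cell_subset: "L \<in> P \<Longrightarrow> L \<subseteq> verts G" "K \<in> Q \<Longrightarrow> K \<subseteq> verts H"
  using P Q by (auto simp: partition_on_def)

lemma cell_nonempty: "L \<in> P \<Longrightarrow> L \<noteq> {}" "K \<in> Q \<Longrightarrow> K \<noteq> {}"
  using P Q by (auto simp: partition_on_def)

lemma finite_cell: "L \<in> P \<Longrightarrow> finite L" "K \<in> Q \<Longrightarrow> finite K"
  using finite_subset[OF cell_subset(1)] finite_subset[OF cell_subset(2)] finite_verts_pqi by auto

lemma finite_partitions: "finite P" "finite Q"
  using finite_elements[OF _ P] finite_elements[OF _ Q] finite_verts_pqi by auto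

lemma sum_cells: "(\<Sum>L\<in>P. sum f L) = sum f (verts G)" "(\<Sum>K\<in>Q. sum g K) = sum g (verts H)"
  using sum.Union_disjoint[of P f] sum.Union_disjoint[of Q g] P Q finite_cell
  by (auto simp: partition_on_def disjoint_def)

lemma column_sum: "x \<in> verts G \<Longrightarrow> (\<Sum>a\<in>verts H. u a x) = 1"
  and row_sum: "a \<in> verts H \<Longrightarrow> (\<Sum>x\<in>verts G. u a x) = 1"
proof -
  obtain e where e: "is_unit_of e (UNIV :: 'x set)"
    and sums: "\<forall>j\<in>verts G. (\<Sum>k\<in>verts H. u k j) = e" "\<forall>i\<in>verts H. (\<Sum>k\<in>verts G. u i k) = e"
    using u by (auto simp: partitioned_quantum_iso_def quantum_iso_def magic_unitary_def)
  \<comment> \<open>The unit of \<open>UNIV\<close> is given only as some \<open>e\<close>; testing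
    it on \<open>1\<close> shows \<open>e = 1\<close>.\<close>
  from e have "e * 1 = 1"
    unfolding is_unit_of_def by blast
  then show "x \<in> verts G \<Longrightarrow> (\<Sum>a\<in>verts H. u a x) = 1"
    and "a \<in> verts H \<Longrightarrow> (\<Sum>x\<in>verts G. u a x) = 1"
    using sums by simp_all
qed

lemma entry_idem: "a \<in> verts H \<Longrightarrow> x \<in> verts G \<Longrightarrow> u a x * u a x = u a x"
  and entry_star: "a \<in> verts H \<Longrightarrow> x \<in> verts G \<Longrightarrow> star (u a x) = u a x"
proof -
  have "\<forall>a\<in>verts H. \<forall>x\<in>verts G. u a x = (u a x)\<^sup>2 \<and> u a x = star (u a x)"
    using u by (auto simp: partitioned_quantum_iso_def quantum_iso_def magic_unitary_def)
  then show "a \<in> verts H \<Longrightarrow> x \<in> verts G \<Longrightarrow> u a x * u a x = u a x"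
    and "a \<in> verts H \<Longrightarrow> x \<in> verts G \<Longrightarrow> star (u a x) = u a x"
    by (metis power2_eq_square)+
qed

lemmas same_cell_iffs = same_cell_iff[OF P] same_cell_iff[OF Q]

lemma entry_orth:
  assumes "x \<in> verts G" "y \<in> verts G" "a \<in> verts H" "b \<in> verts H"
    and "same_cell P x y \<noteq> same_cell Q a b"
  shows "u a x * u b y = 0"
  using u assms by (auto simp: partitioned_quantum_iso_def)

lemma cell_sum_column: "K \<in> Q \<Longrightarrow> L \<in> P \<Longrightarrow> x \<in> L \<Longrightarrow> cell_sum u K L = (\<Sum>d\<in>K. u d x)"
  by (rule cell_sum_eq[OF P Q u])

lemma cell_sum_star:
  assumes K: "K \<in> Q" and L: "L \<in> P"
  shows "star (cell_sum u K L) = cell_sum u K L"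
proof -
  obtain x where x: "x \<in> L"
    using cell_nonempty L by blast
  show ?thesis
    unfolding cell_sum_column[OF K L x] star_sum
    using cell_subset K L x by (intro sum.cong refl entry_star) auto
qed

text \<open>The cell sum may be evaluated in the column \<open>y\<close> itself. There the terms
  with \<open>a\<close> outside \<open>K\<close> vanish against \<open>u b y\<close>, so the sum
  extends to the full column, which is 1.\<close>

lemma cell_sum_mult_left:
  assumes K: "K \<in> Q" and L: "L \<in> P" and b: "b \<in> K" and y: "y \<in> L"
  shows "cell_sum u K L * u b y = u b y"
proof -
  have "cell_sum u K L * u b y = (\<Sum>a\<in>K. u a y * u b y)"
    by (simp add: cell_sum_column[OF K L y] sum_distrib_right)
  also have "\<dots> = (\<Sum>a\<in>verts H. u a y * u b y)"
    using finite_verts_pqi cell_subset K L b y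
    by (intro sum.mono_neutral_left ballI entry_orth) (auto simp: same_cell_iffs)
  also have "\<dots> = u b y"
    using column_sum[of y] cell_subset(1)[OF L] y by (simp add: subset_iff flip: sum_distrib_right)
  finally show ?thesis .
qed

lemma cell_sum_mult_left_zero:
  assumes K: "K \<in> Q" and L: "L \<in> P" and b: "b \<in> verts H" and y: "y \<in> verts G"
    and not: "(b \<in> K) \<noteq> (y \<in> L)"
  shows "cell_sum u K L * u b y = 0"
proof -
  obtain x where x: "x \<in> L"
    using cell_nonempty L by blast
  \<comment> \<open>For \<open>a\<close> in \<open>K\<close> and \<open>x\<close> in
    \<open>L\<close>, being in a common cell with \<open>b\<close> or \<open>y\<close> means
    \<open>b \<in> K\<close> or \<open>y \<in> L\<close>, and exactly one of these holds.\<close>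
  have "u a x * u b y = 0" if "a \<in> K" for a
    using that cell_subset K L x b y not by (intro entry_orth) (auto simp: same_cell_iffs)
  then show ?thesis
    by (simp add: cell_sum_column[OF K L x] sum_distrib_right)
qed

text \<open>This is the adjoint of the left-hand identity, all factors being self-adjoint.\<close>

lemma cell_sum_mult_right:
  assumes K: "K \<in> Q" and L: "L \<in> P" and b: "b \<in> K" and y: "y \<in> L"
  shows "u b y * cell_sum u K L = u b y"
proof -
  have by': "b \<in> verts H" "y \<in> verts G"
    using cell_subset K L b y by auto
  have "star (cell_sum u K L * u b y) = star (u b y)"
    using cell_sum_mult_left[OF K L b y] by simp
  then show ?thesis
    using by' by (simp add: star_mult cell_sum_star[OF K L] entry_star)
qed

lemma cell_sum_idem:
  assumes K: "K \<in> Q" and L: "L \<in> P"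
  shows "cell_sum u K L * cell_sum u K L = cell_sum u K L"
proof -
  obtain x where x: "x \<in> L"
    using cell_nonempty L by blast
  have "cell_sum u K L * cell_sum u K L = (\<Sum>d\<in>K. cell_sum u K L * u d x)"
    \<comment> \<open>Only the second factor is expanded; the first stays intact to be absorbed by
      each entry.\<close>
    by (subst (2) cell_sum_column[OF K L x]) (simp add: sum_distrib_left)
  also have "\<dots> = (\<Sum>d\<in>K. u d x)"
    using cell_subset K L x by (intro sum.cong refl cell_sum_mult_left) auto
  finally show ?thesis
    using cell_sum_column[OF K L x] by simp
qed

text \<open>The cell sum is multiplied by the full row sum 1 of \<open>b\<close>, and it kills the
  entries of that row outside \<open>L\<close>. This provides the row sums both of the block and of
  the matrix of cell sums.\<close>

lemma cell_sum_row:
  assumes K: "K \<in> Q" and L: "L \<in> P" and b: "b \<in> K"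
  shows "cell_sum u K L = (\<Sum>y\<in>L. u b y)"
proof -
  have bH: "b \<in> verts H"
    using cell_subset K b by auto
  have "cell_sum u K L = (\<Sum>y\<in>verts G. cell_sum u K L * u b y)"
    using row_sum[OF bH] by (simp flip: sum_distrib_left)
  also have "\<dots> = (\<Sum>y\<in>L. cell_sum u K L * u b y)"
    using finite_verts_pqi cell_subset K L b bH
    by (intro sum.mono_neutral_right ballI cell_sum_mult_left_zero) auto
  also have "\<dots> = (\<Sum>y\<in>L. u b y)"
    using cell_subset K L b bH by (intro sum.cong refl cell_sum_mult_left) auto
  finally show ?thesis .
qed

section \<open>The matrix of cell sums, the blocks and their intertwining relation\<close>

lemma magic_unitary_cell_sum: "magic_unitary UNIV Q P (cell_sum u)"
  unfolding magic_unitary_def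
proof (intro conjI ballI exI[of _ 1])
  show "cstar_subalgebra (UNIV :: 'x set)" "is_unit_of 1 (UNIV :: 'x set)"
    by (auto simp: cstar_subalgebra_def is_unit_of_def)
  show "cell_sum u K L = (cell_sum u K L)\<^sup>2" "cell_sum u K L = star (cell_sum u K L)"
    if "K \<in> Q" "L \<in> P" for K L
    using that cell_sum_idem cell_sum_star by (auto simp: power2_eq_square)
  show "(\<Sum>K\<in>Q. cell_sum u K L) = 1" if L: "L \<in> P" for L
  proof -
    obtain x where x: "x \<in> L"
      using cell_nonempty L by blast
    \<comment> \<open>One column \<open>x\<close> of \<open>L\<close> serves for all
      \<open>K\<close>, so the cells of \<open>Q\<close> cut up a single full column.\<close>
    have "(\<Sum>K\<in>Q. cell_sum u K L) = (\<Sum>K\<in>Q. \<Sum>d\<in>K. u d x)"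
      by (intro sum.cong refl cell_sum_column L x)
    also have "\<dots> = 1"
      using sum_cells(2)[of "\<lambda>d. u d x"] column_sum[of x] cell_subset(1)[OF L] x by auto
    finally show ?thesis .
  qed
  show "(\<Sum>L\<in>P. cell_sum u K L) = 1" if K: "K \<in> Q" for K
  proof -
    obtain b where b: "b \<in> K"
      using cell_nonempty K by blast
    \<comment> \<open>Dually, the cells of \<open>P\<close> cut up the full row of one
      \<open>b\<close> in \<open>K\<close>.\<close>
    have "(\<Sum>L\<in>P. cell_sum u K L) = (\<Sum>L\<in>P. \<Sum>y\<in>L. u b y)"
      by (intro sum.cong refl cell_sum_row K b)
    also have "\<dots> = 1"
      using sum_cells(1)[of "\<lambda>y. u b y"] row_sum[of b] cell_subset(2)[OF K] b by auto
    finally show ?thesis .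
  qed
qed (auto simp: finite_partitions)

text \<open>The cell sum lies in the generated subalgebra as a sum of entries of one block column,
  and it fixes every generator from both sides.\<close>

lemma is_unit_of_cell_sum:
  assumes K: "K \<in> Q" and L: "L \<in> P"
  shows "is_unit_of (cell_sum u K L) (cstar_generated (entries K L u))"
proof (rule is_unit_of_cstar_generated)
  show "star (cell_sum u K L) = cell_sum u K L"
    by (rule cell_sum_star[OF K L])
  obtain x where x: "x \<in> L"
    using cell_nonempty L by blast
  have "u d x \<in> cstar_generated (entries K L u)" if "d \<in> K" for d
    using that x subset_cstar_generated[of "entries K L u"] by (auto simp: entries_def)
  then show "cell_sum u K L \<in> cstar_generated (entries K L u)"
    unfolding cell_sum_column[OF K L x]
    by (intro cstar_subalgebra_sum cstar_subalgebra_cstar_generated)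
  show "cell_sum u K L * z = z \<and> z * cell_sum u K L = z" if "z \<in> entries K L u" for z
    using that cell_sum_mult_left[OF K L] cell_sum_mult_right[OF K L]
    by (auto simp: entries_def)
qed

lemma cell_sum_zero_imp_entry_zero:
  assumes K: "K \<in> Q" and L: "L \<in> P" and "cell_sum u K L = 0" and "d \<in> K" and "c \<in> L"
  shows "u d c = 0"
  using cell_sum_mult_right[OF K L] assms by fastforce

lemma magic_unitary_submatrix:
  assumes K: "K \<in> Q" and L: "L \<in> P" and "cell_sum u K L \<noteq> 0"
  shows "magic_unitary (cstar_generated (entries K L u)) K L u"
  unfolding magic_unitary_def
proof (intro conjI ballI exI[of _ "cell_sum u K L"])
  show "u i j = (u i j)\<^sup>2" "u i j = star (u i j)" if "i \<in> K" "j \<in> L" for i j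
    using that cell_subset K L entry_idem entry_star by (auto simp: power2_eq_square subset_iff)
  show "(\<Sum>k\<in>K. u k j) = cell_sum u K L" if "j \<in> L" for j
    using cell_sum_column[OF K L that] by simp
  show "(\<Sum>k\<in>L. u i k) = cell_sum u K L" if "i \<in> K" for i
    using cell_sum_row[OF K L that] by simp
qed (use assms in \<open>simp_all add: cstar_subalgebra_cstar_generated subset_cstar_generated finite_cell
      is_unit_of_cell_sum\<close>)

lemma adj_matrix_intertwines_submatrix:
  assumes K: "K \<in> Q" and L: "L \<in> P" and d: "d \<in> K" and c: "c \<in> L"
  shows "scalar_mat_mult K (adj_matrix H) u d c = mat_scalar_mult L u (adj_matrix G) d c"
proof -
  let ?p = "cell_sum u K L"
  have dc: "d \<in> verts H" "c \<in> verts G"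
    using cell_subset K L d c by auto
  have "scalar_mat_mult K (adj_matrix H) u d c = (\<Sum>a\<in>K. adj_matrix H d a *\<^sub>C (?p * u a c))"
    unfolding scalar_mat_mult_def
    using cell_subset K L c by (intro sum.cong refl) (simp add: cell_sum_mult_left subset_iff)
  \<comment> \<open>In the column \<open>c\<close> of the block, \<open>?p\<close> kills every entry
    with \<open>a\<close> outside \<open>K\<close>, so the sum can run over all rows and the global
    relation applies.\<close>
  also have "\<dots> = (\<Sum>a\<in>verts H. adj_matrix H d a *\<^sub>C (?p * u a c))"
    using finite_verts_pqi cell_subset K L c dc
    by (intro sum.mono_neutral_left) (auto simp: cell_sum_mult_left_zero)
  also have "\<dots> = ?p * scalar_mat_mult (verts H) (adj_matrix H) u d c"
    by (simp add: scalar_mat_mult_def sum_distrib_left mult_scaleC_right)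
  also have "\<dots> = ?p * mat_scalar_mult (verts G) u (adj_matrix G) d c"
    using u dc by (simp add: partitioned_quantum_iso_def quantum_iso_def)
  also have "\<dots> = (\<Sum>x\<in>verts G. adj_matrix G x c *\<^sub>C (?p * u d x))"
    by (simp add: mat_scalar_mult_def sum_distrib_left mult_scaleC_right)
  \<comment> \<open>In the row \<open>d\<close> of the block, \<open>?p\<close> kills every entry
    outside \<open>L\<close>, which contracts the sum to the block again.\<close>
  also have "\<dots> = (\<Sum>x\<in>L. adj_matrix G x c *\<^sub>C (?p * u d x))"
    using finite_verts_pqi cell_subset K L d dc
    by (intro sum.mono_neutral_right) (auto simp: cell_sum_mult_left_zero)
  also have "\<dots> = mat_scalar_mult L u (adj_matrix G) d c"
    unfolding mat_scalar_mult_def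
    using cell_subset K L d by (intro sum.cong refl) (simp add: cell_sum_mult_left subset_iff)
  finally show ?thesis .
qed

text \<open>Equality of the numbers of vertices of the two induced subgraphs is not part of the
  data; it follows from the block being a magic unitary, hence square.\<close>

lemma quantum_iso_induce_subgraph:
  assumes K: "K \<in> Q" and L: "L \<in> P" and "cell_sum u K L \<noteq> 0"
  shows "quantum_iso (cstar_generated (entries K L u)) (G \<restriction> L) (H \<restriction> K) u"
proof -
  have magic: "magic_unitary (cstar_generated (entries K L u)) K L u"
    by (rule magic_unitary_submatrix[OF assms])
  have "scalar_mat_mult K (adj_matrix (H \<restriction> K)) u d c = scalar_mat_mult K (adj_matrix H) u d c"
    "mat_scalar_mult L u (adj_matrix (G \<restriction> L)) d c = mat_scalar_mult L u (adj_matrix G) d c"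
    if "d \<in> K" "c \<in> L" for d c
    unfolding scalar_mat_mult_def mat_scalar_mult_def
    using that by (auto intro!: sum.cong simp: adj_matrix_induce_subgraph)
  then show ?thesis
    using magic magic_unitary_card_eq[OF magic] adj_matrix_intertwines_submatrix[OF K L]
    by (simp add: quantum_iso_def)
qed

end

theorem theorem3p3:
  fixes G :: "('g, 'e) pre_digraph" and H :: "('h, 'f) pre_digraph"
    and PG :: "'g set set" and PH :: "'h set set"
    and U :: "'h \<Rightarrow> 'g \<Rightarrow> 'x::cstar_algebra_1"
  assumes "partitioned_graph G PG" and "partitioned_graph H PH"
    and "partitioned_quantum_iso UNIV G PG H PH U"
  shows "magic_unitary UNIV PH PG (cell_sum U)
    \<and> (\<forall>C\<in>PG. \<forall>D\<in>PH. \<forall>p Y. p = cell_sum U D C \<and> Y = cstar_generated (entries D C U) \<longrightarrow>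
        (p \<noteq> 0 \<longrightarrow> is_unit_of p Y)
        \<and> (p = 0 \<longrightarrow> (\<forall>d\<in>D. \<forall>c\<in>C. U d c = 0))
        \<and> (p \<noteq> 0 \<longrightarrow> magic_unitary Y D C U)
        \<and> (\<forall>d\<in>D. \<forall>c\<in>C. scalar_mat_mult D (adj_matrix H) U d c
                         = mat_scalar_mult C U (adj_matrix G) d c))
    \<and> (\<exists>\<phi>. bij_betw \<phi> PG PH \<and>
        (\<forall>S\<in>PG. quantum_iso (cstar_generated (entries (\<phi> S) S U))
                   (G \<restriction> S) (H \<restriction> \<phi> S) U))"
proof -
  have P: "partition_on (verts G) PG" and Q: "partition_on (verts H) PH"
    using assms(1,2) by (auto simp: partitioned_graph_def)
  note pqi = P Q assms(3)
  have magic: "magic_unitary UNIV PH PG (cell_sum U)"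
    by (rule magic_unitary_cell_sum[OF pqi])
  \<comment> \<open>Nonvanishing along the bijection supplies the nonzero units that make the chosen
    blocks magic unitaries.\<close>
  obtain \<phi> where \<phi>: "bij_betw \<phi> PG PH" "\<forall>S\<in>PG. cell_sum U (\<phi> S) S \<noteq> 0"
    using magic_unitary_transversal[OF magic] by blast
  then have "quantum_iso (cstar_generated (entries (\<phi> S) S U)) (G \<restriction> S) (H \<restriction> \<phi> S) U"
    if "S \<in> PG" for S
    using that quantum_iso_induce_subgraph[OF pqi] bij_betwE by blast
  then show ?thesis
    using magic \<phi>(1) is_unit_of_cell_sum[OF pqi] cell_sum_zero_imp_entry_zero[OF pqi]
      magic_unitary_submatrix[OF pqi] adj_matrix_intertwines_submatrix[OF pqi]
    by (intro conjI exI[of _ \<phi>] ballI allI impI) auto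
qed

end
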